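(* Let $O$ be a finite set. Let $\mathcal{P}_O$ be the simplicial set whose $n$-simplices are the probability distributions $P$ on $O^{n+1}$, written $P(a_0,\dots,a_n)$, with $$(Pf)(a_0,\dots,a_m):=\sum_{(b_0,\dots,b_n)\in O^{n+1}\ :\ a_i=b_{f(i)}\ \forall i}P(b_0,\dots,b_n)$$ for $f\in\Delta([m],[n])$ and $P\in\mathcal{P}_O(n)$. For a $k$-composable pair $(P,Q)\in\mathcal{P}_O(m)\times\mathcal{P}_O(n)$, let $$R(a_{m-k},\dots,a_m):=\sum_{a_0,\dots,a_{m-k-1}}P(a_0,\dots,a_m)=\sum_{a_{m+1},\dots,a_{m+n-k}}Q(a_{m-k},\dots,a_{m+n-k})$$ and put $$(P\circ_k Q)(a_0,\dots,a_{m+n-k}):=\frac{P(a_0,\dots,a_m)\,Q(a_{m-k},\dots,a_{m+n-k})}{R(a_{m-k},\dots,a_m)},$$ where the right-hand side is taken to be $0$ whenever the denominator vanishes. With these definitions, $\mathcal{P}_O$ is a compository.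
   Context: **Simplicial conventions.** $\mathbb{N}$ includes $0$. $\Delta$ is the category of nonempty finite ordinals $[n]=\{0,\dots,n\}$ and order-preserving maps. A simplicial set is a functor $\mathcal{C}:\Delta^{\mathrm{op}}\to\mathbf{Set}$; write $\mathcal{C}(n)=\mathcal{C}([n])$, and for $f:[m]\to[n]$ and $A\in\mathcal{C}(n)$ write $Af:=\mathcal{C}(f)(A)\in\mathcal{C}(m)$. The map $\partial_k:[n-1]\to[n]$ is the injective order-preserving map omitting $k$; $\eta_k:[n+1]\to[n]$ is the surjective order-preserving map hitting $k$ twice. For $k\le n$, $s_k:[k]\to[n]$ is $v\mapsto v$ and $t_k:[k]\to[n]$ is $v\mapsto v+n-k$; the codomain index $n$ is left implicit. **Compositories.** A pair $(A,B)\in\mathcal{C}(m)\times\mathcal{C}(n)$ is $k$-composable ($k\le m,n$) if $At_k=Bs_k$. A compository is a simplicial set $\mathcal{C}$ with an element $A\circ_k B\in\mathcal{C}(m+n-k)$ for every $k\in\mathbb{N}$ and every $k$-composable pair $(A,B)\in\mathcal{C}(m)\times\mathcal{C}(n)$, such that: 1. (Identity) $As_k\circ_k A=A$ and $A\circ_k At_k=A$. And for every $k$-composable $(A,B)\in\mathcal{C}(m)\times\mathcal{C}(n)$: 2. (Back-and-forth) $(A\circ_k B)s_{m+i}\circ_{k+i}B=A\circ_k B$ for $0\le i\le n-k$; $A\circ_{k+j}(A\circ_k B)t_{n+j}=A\circ_k B$ for $0\le j\le m-k$. 3. (Degeneracies) $(A\circ_k B)\eta_i=A\eta_i\circ_k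 B$ for $i\le m-k$; $(A\circ_k B)\eta_i=A\circ_k B\eta_{i-m+k}$ for $i\ge m$; $(A\circ_k B)\eta_i=A\eta_i\circ_{k+1}B\eta_{i-m+k}$ for $m-k\le i\le m$. 4. (Faces) $(A\circ_k B)\partial_i=A\partial_i\circ_k B$ for $i<m-k$; $(A\circ_k B)\partial_i=A\circ_k B\partial_{i-m+k}$ for $i>m$. *)

theory Defs
  imports "HOL-Probability.Probability_Mass_Function"
begin

section \<open>Simplicial sets\<close>

text \<open>The object \<open>[n]\<close> of the simplex category is \<open>{..n}\<close>. A morphism \<open>[m] \<rightarrow> [n]\<close> is
  an extensional function, so that equality of morphisms is HOL equality; composition is
  \<^term>\<open>compose {..l} g f\<close>.\<close>

definition simplex_hom :: "nat \<Rightarrow> nat \<Rightarrow> (nat \<Rightarrow> nat) set" where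
  "simplex_hom m n = {f \<in> {..m} \<rightarrow>\<^sub>E {..n}. mono_on {..m} f}"

text \<open>\<open>s_map k\<close> is \<open>s\<^sub>k : [k] \<rightarrow> [n]\<close> for every \<open>n \<ge> k\<close>, and \<open>t_map k n\<close> is
  \<open>t\<^sub>k : [k] \<rightarrow> [n]\<close> for \<open>k \<le> n\<close>.\<close>

definition s_map :: "nat \<Rightarrow> nat \<Rightarrow> nat" where
  "s_map k = (\<lambda>v\<in>{..k}. v)"

definition t_map :: "nat \<Rightarrow> nat \<Rightarrow> nat \<Rightarrow> nat" where
  "t_map k n = (\<lambda>v\<in>{..k}. v + (n - k))"

text \<open>\<open>face_map n k\<close> is \<open>\<partial>\<^sub>k : [n - 1] \<rightarrow> [n]\<close>, meaningful for \<open>n \<ge> 1\<close> and \<open>k \<le> n\<close>;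
  \<open>degen_map n k\<close> is \<open>\<eta>\<^sub>k : [n + 1] \<rightarrow> [n]\<close> for \<open>k \<le> n\<close>.\<close>

definition face_map :: "nat \<Rightarrow> nat \<Rightarrow> nat \<Rightarrow> nat" where
  "face_map n k = (\<lambda>v\<in>{..n - 1}. if v < k then v else v + 1)"

definition degen_map :: "nat \<Rightarrow> nat \<Rightarrow> nat \<Rightarrow> nat" where
  "degen_map n k = (\<lambda>v\<in>{..n + 1}. if v \<le> k then v else v - 1)"

lemma s_map_hom: "k \<le> n \<Longrightarrow> s_map k \<in> simplex_hom k n"
  by (auto simp: s_map_def simplex_hom_def monotone_on_def)

lemma t_map_hom: "k \<le> n \<Longrightarrow> t_map k n \<in> simplex_hom k n"
  by (auto simp: t_map_def simplex_hom_def monotone_on_def)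

lemma face_map_hom: "1 \<le> n \<Longrightarrow> k \<le> n \<Longrightarrow> face_map n k \<in> simplex_hom (n - 1) n"
  by (auto simp: face_map_def simplex_hom_def monotone_on_def)

lemma degen_map_hom: "k \<le> n \<Longrightarrow> degen_map n k \<in> simplex_hom (n + 1) n"
  by (auto simp: degen_map_def simplex_hom_def monotone_on_def)

text \<open>\<open>X n\<close> is the set of \<open>n\<close>-simplices and \<open>act m n f A\<close> is \<open>A f \<in> X m\<close> for
  \<open>f : [m] \<rightarrow> [n]\<close> and \<open>A \<in> X n\<close>. The sets \<open>X n\<close> need not be disjoint, hence the explicit
  dimensions.\<close>

locale simplicial_set =
  fixes X :: "nat \<Rightarrow> 'a set"
    and act :: "nat \<Rightarrow> nat \<Rightarrow> (nat \<Rightarrow> nat) \<Rightarrow> 'a \<Rightarrow> 'a"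
  assumes act_closed: "f \<in> simplex_hom m n \<Longrightarrow> A \<in> X n \<Longrightarrow> act m n f A \<in> X m"
    and act_id: "A \<in> X n \<Longrightarrow> act n n (\<lambda>i\<in>{..n}. i) A = A"
    and act_compose: "f \<in> simplex_hom l m \<Longrightarrow> g \<in> simplex_hom m n \<Longrightarrow> A \<in> X n \<Longrightarrow>
      act l n (compose {..l} g f) A = act l m f (act m n g A)"
begin

definition composable :: "nat \<Rightarrow> nat \<Rightarrow> nat \<Rightarrow> 'a \<Rightarrow> 'a \<Rightarrow> bool" where
  "composable k m n A B \<longleftrightarrow>
     k \<le> m \<and> k \<le> n \<and> A \<in> X m \<and> B \<in> X n \<and> act k m (t_map k m) A = act k n (s_map k) B"

end


section \<open>Compositories\<close>

text \<open>\<open>cmp k m n A B\<close> is \<open>A \<circ>\<^sub>k B\<close> for \<open>A \<in> X m\<close> and \<open>B \<in> X n\<close>; its value is irrelevant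
  unless \<open>A, B\<close> are \<open>k\<close>-composable. As \<open>\<circ>\<^sub>k\<close> is a partial operation, each law also asserts
  that the compositions occurring in it are defined. The index \<open>i - m + k\<close> is
  written \<open>i + k - m\<close> because of truncated subtraction.\<close>

locale compository = simplicial_set X act
  for X :: "nat \<Rightarrow> 'a set"
    and act :: "nat \<Rightarrow> nat \<Rightarrow> (nat \<Rightarrow> nat) \<Rightarrow> 'a \<Rightarrow> 'a" +
  fixes cmp :: "nat \<Rightarrow> nat \<Rightarrow> nat \<Rightarrow> 'a \<Rightarrow> 'a \<Rightarrow> 'a"
  assumes cmp_closed: "composable k m n A B \<Longrightarrow> cmp k m n A B \<in> X (m + n - k)"
    and identity_left: "A \<in> X n \<Longrightarrow> k \<le> n \<Longrightarrow>
      composable k k n (act k n (s_map k) A) A \<and>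
      cmp k k n (act k n (s_map k) A) A = A"
    and identity_right: "A \<in> X n \<Longrightarrow> k \<le> n \<Longrightarrow>
      composable k n k A (act k n (t_map k n) A) \<and>
      cmp k n k A (act k n (t_map k n) A) = A"
    and back_and_forth_left: "composable k m n A B \<Longrightarrow> i \<le> n - k \<Longrightarrow>
      composable (k + i) (m + i) n (act (m + i) (m + n - k) (s_map (m + i)) (cmp k m n A B)) B \<and>
      cmp (k + i) (m + i) n (act (m + i) (m + n - k) (s_map (m + i)) (cmp k m n A B)) B
        = cmp k m n A B"
    and back_and_forth_right: "composable k m n A B \<Longrightarrow> j \<le> m - k \<Longrightarrow>
      composable (k + j) m (n + j) A
        (act (n + j) (m + n - k) (t_map (n + j) (m + n - k)) (cmp k m n A B)) \<and>
      cmp (k + j) m (n + j) A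
        (act (n + j) (m + n - k) (t_map (n + j) (m + n - k)) (cmp k m n A B))
        = cmp k m n A B"
    and degeneracy_left: "composable k m n A B \<Longrightarrow> i \<le> m - k \<Longrightarrow>
      composable k (m + 1) n (act (m + 1) m (degen_map m i) A) B \<and>
      act (m + n - k + 1) (m + n - k) (degen_map (m + n - k) i) (cmp k m n A B)
        = cmp k (m + 1) n (act (m + 1) m (degen_map m i) A) B"
    and degeneracy_right: "composable k m n A B \<Longrightarrow> m \<le> i \<Longrightarrow> i \<le> m + n - k \<Longrightarrow>
      composable k m (n + 1) A (act (n + 1) n (degen_map n (i + k - m)) B) \<and>
      act (m + n - k + 1) (m + n - k) (degen_map (m + n - k) i) (cmp k m n A B)
        = cmp k m (n + 1) A (act (n + 1) n (degen_map n (i + k - m)) B)"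
    and degeneracy_middle: "composable k m n A B \<Longrightarrow> m - k \<le> i \<Longrightarrow> i \<le> m \<Longrightarrow>
      composable (k + 1) (m + 1) (n + 1) (act (m + 1) m (degen_map m i) A)
        (act (n + 1) n (degen_map n (i + k - m)) B) \<and>
      act (m + n - k + 1) (m + n - k) (degen_map (m + n - k) i) (cmp k m n A B)
        = cmp (k + 1) (m + 1) (n + 1) (act (m + 1) m (degen_map m i) A)
            (act (n + 1) n (degen_map n (i + k - m)) B)"
    and face_left: "composable k m n A B \<Longrightarrow> i < m - k \<Longrightarrow>
      composable k (m - 1) n (act (m - 1) m (face_map m i) A) B \<and>
      act (m + n - k - 1) (m + n - k) (face_map (m + n - k) i) (cmp k m n A B)
        = cmp k (m - 1) n (act (m - 1) m (face_map m i) A) B"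
    and face_right: "composable k m n A B \<Longrightarrow> m < i \<Longrightarrow> i \<le> m + n - k \<Longrightarrow>
      composable k m (n - 1) A (act (n - 1) n (face_map n (i + k - m)) B) \<and>
      act (m + n - k - 1) (m + n - k) (face_map (m + n - k) i) (cmp k m n A B)
        = cmp k m (n - 1) A (act (n - 1) n (face_map n (i + k - m)) B)"


section \<open>Joint distributions\<close>

text \<open>\<open>words \<Omega> l\<close> is \<open>\<Omega>\<^sup>l\<close>. A distribution on a power of \<open>\<Omega>\<close> is represented by its
  mass function, which vanishes on lists outside that power.\<close>

definition words :: "'o set \<Rightarrow> nat \<Rightarrow> 'o list set" where
  "words \<Omega> l = {a. length a = l \<and> set a \<subseteq> \<Omega>}"

definition joint_dist :: "'o set \<Rightarrow> nat \<Rightarrow> ('o list \<Rightarrow> real) set" where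
  "joint_dist \<Omega> n = pmf ` {p. set_pmf p \<subseteq> words \<Omega> (n + 1)}"

definition dist_act ::
    "'o set \<Rightarrow> nat \<Rightarrow> nat \<Rightarrow> (nat \<Rightarrow> nat) \<Rightarrow> ('o list \<Rightarrow> real) \<Rightarrow> 'o list \<Rightarrow> real" where
  "dist_act \<Omega> m n f P =
     (\<lambda>a. if a \<in> words \<Omega> (m + 1)
          then \<Sum>b\<in>{b \<in> words \<Omega> (n + 1). \<forall>i\<le>m. a ! i = b ! f i}. P b
          else 0)"

text \<open>The common marginal \<open>R\<close> of a \<open>k\<close>-composable pair \<open>P, Q\<close>, computed from \<open>P\<close>;
  \<open>overlap_eq\<close> below is the agreement with the one computed from \<open>Q\<close>.\<close>

definition overlap :: "'o set \<Rightarrow> nat \<Rightarrow> nat \<Rightarrow> ('o list \<Rightarrow> real) \<Rightarrow> 'o list \<Rightarrow> real" where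
  "overlap \<Omega> k m P r = (\<Sum>p\<in>words \<Omega> (m - k). P (p @ r))"

text \<open>For \<open>a = (a\<^sub>0, \<dots>, a\<^bsub>m+n-k\<^esub>)\<close>, the arguments of \<open>P\<close>, \<open>Q\<close> and \<open>R\<close> are the blocks
  \<open>0..m\<close>, \<open>m-k..m+n-k\<close> and \<open>m-k..m\<close>. The convention for a vanishing denominator is that of
  HOL division, \<open>x / 0 = 0\<close>.\<close>

definition dist_cmp ::
    "'o set \<Rightarrow> nat \<Rightarrow> nat \<Rightarrow> nat \<Rightarrow> ('o list \<Rightarrow> real) \<Rightarrow> ('o list \<Rightarrow> real) \<Rightarrow> 'o list \<Rightarrow> real" where
  "dist_cmp \<Omega> k m n P Q =
     (\<lambda>a. if a \<in> words \<Omega> (m + n - k + 1)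
          then P (take (m + 1) a) * Q (drop (m - k) a)
                 / overlap \<Omega> k m P (take (k + 1) (drop (m - k) a))
          else 0)"

lemma overlap_eq:
  assumes "k \<le> m" "k \<le> n" "r \<in> words \<Omega> (k + 1)"
    and "dist_act \<Omega> k m (t_map k m) P = dist_act \<Omega> k n (s_map k) Q"
  shows "overlap \<Omega> k m P r = (\<Sum>q\<in>words \<Omega> (n - k). Q (r @ q))"
proof -
  have r: "length r = k + 1" "set r \<subseteq> \<Omega>"
    using assms(3) by (auto simp: words_def)
  have "dist_act \<Omega> k m (t_map k m) P r
      = (\<Sum>b\<in>{b \<in> words \<Omega> (m + 1). \<forall>i\<le>k. r ! i = b ! (i + (m - k))}. P b)"
    using assms(3) by (simp add: dist_act_def t_map_def cong: conj_cong)
  also have "\<dots> = overlap \<Omega> k m P r"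
    unfolding overlap_def
  proof (rule sum.reindex_bij_witness[of _ "\<lambda>p. p @ r" "take (m - k)"])
    fix b assume b: "b \<in> {b \<in> words \<Omega> (m + 1). \<forall>i\<le>k. r ! i = b ! (i + (m - k))}"
    have "drop (m - k) b = r"
      using b assms(1) r by (intro nth_equalityI) (auto simp: words_def add.commute)
    then show "take (m - k) b @ r = b"
      by (metis append_take_drop_id)
    then show "P (take (m - k) b @ r) = P b" by simp
    show "take (m - k) b \<in> words \<Omega> (m - k)"
      using b by (auto simp: words_def dest: in_set_takeD)
  next
    fix p assume p: "p \<in> words \<Omega> (m - k)"
    then show "take (m - k) (p @ r) = p" by (simp add: words_def)
    show "p @ r \<in> {b \<in> words \<Omega> (m + 1). \<forall>i\<le>k. r ! i = b ! (i + (m - k))}"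
      using p assms(1) r by (auto simp: words_def nth_append)
  qed
  finally have 1: "dist_act \<Omega> k m (t_map k m) P r = overlap \<Omega> k m P r" .
  have "dist_act \<Omega> k n (s_map k) Q r
      = (\<Sum>b\<in>{b \<in> words \<Omega> (n + 1). \<forall>i\<le>k. r ! i = b ! i}. Q b)"
    using assms(3) by (simp add: dist_act_def s_map_def cong: conj_cong)
  also have "\<dots> = (\<Sum>q\<in>words \<Omega> (n - k). Q (r @ q))"
  proof (rule sum.reindex_bij_witness[of _ "\<lambda>q. r @ q" "drop (k + 1)"])
    fix b assume b: "b \<in> {b \<in> words \<Omega> (n + 1). \<forall>i\<le>k. r ! i = b ! i}"
    have "take (k + 1) b = r"
      using b assms(2) r by (intro nth_equalityI) (auto simp: words_def)
    then show "r @ drop (k + 1) b = b"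
      by (metis append_take_drop_id)
    then show "Q (r @ drop (k + 1) b) = Q b" by simp
    show "drop (k + 1) b \<in> words \<Omega> (n - k)"
      using b by (auto simp: words_def dest: in_set_dropD)
  next
    fix q assume q: "q \<in> words \<Omega> (n - k)"
    then show "drop (k + 1) (r @ q) = q" using r by simp
    show "r @ q \<in> {b \<in> words \<Omega> (n + 1). \<forall>i\<le>k. r ! i = b ! i}"
      using q assms(2) r by (auto simp: words_def nth_append)
  qed
  finally show ?thesis
    using 1 assms(4) by simp
qed

end

theory Submission imports Defs begin

text \<open>The composition of \<open>P\<close> and \<open>Q\<close> is the unique distribution \<open>D\<close> that has \<open>P\<close> as the marginal of its
  initial block \<open>0..m\<close>, has \<open>Q\<close> as the marginal of its final block \<open>m-k..m+n-k\<close>, and makes the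
  two blocks conditionally independent given their overlap \<open>m-k..m\<close>. Conditional independence
  is equivalent to the mere existence of a factorization \<open>D = f \<cdot> g\<close>, in which \<open>f\<close> reads only the
  initial and \<open>g\<close> only the final block: summing out the variables of either block gives
  \<open>P = f \<cdot> G\<close>, \<open>Q = F \<cdot> g\<close> and \<open>R = F \<cdot> G\<close>, where \<open>F\<close> and \<open>G\<close> depend on the overlap only, so
  that \<open>P \<cdot> Q / R = f \<cdot> g\<close> wherever \<open>R \<noteq> 0\<close>. Hence a distribution that factorizes in this way is the composition
  of its two marginals (\<open>factorizes_imp_dist_cmp_marginals\<close>), and every law of a compository
  reduces to two questions about its left-hand side: does it factorize, and what are its marginals?

  Marginals are found by functoriality, because \<open>P \<circ>\<^sub>k Q\<close> has marginals \<open>P\<close> and \<open>Q\<close>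
  (\<open>dist_cmp_marginals\<close>). As for factorization, the identity laws have the trivial factors \<open>1 \<cdot> A\<close>
  and \<open>A \<cdot> 1\<close>, and in the back-and-forth laws the factors of \<open>P \<cdot> Q / R\<close> are regrouped. For
  degeneracies and faces, let \<open>h\<close> be any map that respects the blocks and whose values on the
  overlap cover the old overlap. A word \<open>b\<close> with \<open>b h = a\<close> then has its overlap
  determined by \<open>a\<close>, so the two halves of \<open>b\<close> can be chosen independently, and the sum defining
  the action of \<open>h\<close> on \<open>f \<cdot> g\<close> splits into a product (\<open>factorizes_dist_act\<close>). This makes composition
  natural in such \<open>h\<close> (\<open>dist_cmp_natural\<close>), and all five laws are instances. The
  covering condition is what excludes a face that omits a vertex of the overlap: marginalizing a
  common cause destroys conditional independence.\<close>

section \<open>Words and their pullbacks\<close>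

lemma finite_words: "finite \<Omega> \<Longrightarrow> finite (words \<Omega> l)"
  using finite_lists_length_eq[of \<Omega> l] by (simp add: words_def conj_commute)

lemma take_words: "a \<in> words \<Omega> l \<Longrightarrow> j \<le> l \<Longrightarrow> take j a \<in> words \<Omega> j"
  by (auto simp: words_def dest: in_set_takeD)

lemma drop_words: "a \<in> words \<Omega> l \<Longrightarrow> drop j a \<in> words \<Omega> (l - j)"
  by (auto simp: words_def dest: in_set_dropD)

lemma append_words: "a \<in> words \<Omega> i \<Longrightarrow> b \<in> words \<Omega> j \<Longrightarrow> a @ b \<in> words \<Omega> (i + j)"
  by (auto simp: words_def)

lemma simplex_hom_le: "f \<in> simplex_hom m n \<Longrightarrow> i \<le> m \<Longrightarrow> f i \<le> n"
  by (auto simp: simplex_hom_def)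

lemma simplex_hom_id: "(\<lambda>i\<in>{..n}. i) \<in> simplex_hom n n"
  by (auto simp: simplex_hom_def monotone_on_def)

definition pullback :: "(nat \<Rightarrow> nat) \<Rightarrow> nat \<Rightarrow> 'o list \<Rightarrow> 'o list" where
  "pullback f m b = map (\<lambda>i. b ! f i) [0..<Suc m]"

lemma pullback_words:
  assumes "f \<in> simplex_hom m n" "b \<in> words \<Omega> (n + 1)"
  shows "pullback f m b \<in> words \<Omega> (m + 1)"
proof -
  have "b ! f i \<in> \<Omega>" if "i \<le> m" for i
    using assms(2) simplex_hom_le[OF assms(1) that] nth_mem[of "f i" b]
    by (auto simp: words_def simp del: nth_mem)
  then show ?thesis
    by (auto simp: words_def pullback_def)
qed

lemma pullback_eq_iff:
  "length a = m + 1 \<Longrightarrow> pullback f m b = a \<longleftrightarrow> (\<forall>i\<le>m. a ! i = b ! f i)"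
  by (auto simp: pullback_def list_eq_iff_nth_eq less_Suc_eq_le simp del: upt_Suc)

lemma pullback_id: "length b = n + 1 \<Longrightarrow> pullback (\<lambda>i\<in>{..n}. i) n b = b"
  by (simp add: pullback_eq_iff)

lemma pullback_compose:
  assumes "f \<in> simplex_hom l m"
  shows "pullback (compose {..l} g f) l b = pullback f l (pullback g m b)"
  using simplex_hom_le[OF assms]
  by (auto simp: pullback_def compose_def less_Suc_eq_le simp del: upt_Suc)

section \<open>The simplicial set of joint distributions\<close>

lemma joint_distE:
  assumes "P \<in> joint_dist \<Omega> n"
  obtains p where "P = pmf p" "set_pmf p \<subseteq> words \<Omega> (n + 1)"
  using assms by (auto simp: joint_dist_def)

lemma joint_dist_nonneg: "P \<in> joint_dist \<Omega> n \<Longrightarrow> 0 \<le> P a"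
  by (auto elim: joint_distE)

lemma joint_dist_zero: "P \<in> joint_dist \<Omega> n \<Longrightarrow> a \<notin> words \<Omega> (n + 1) \<Longrightarrow> P a = 0"
  by (erule joint_distE) (auto simp: pmf_eq_0_set_pmf)

lemma joint_distI:
  assumes "finite \<Omega>" "\<And>a. 0 \<le> P a" "\<And>a. a \<notin> words \<Omega> (n + 1) \<Longrightarrow> P a = 0"
    and "sum P (words \<Omega> (n + 1)) = 1"
  shows "P \<in> joint_dist \<Omega> n"
proof -
  let ?W = "words \<Omega> (n + 1)"
  have "(\<integral>\<^sup>+a. ennreal (P a) \<partial>count_space UNIV) = (\<Sum>a\<in>?W. ennreal (P a))"
    using assms finite_words[OF assms(1)]
    by (intro nn_integral_count_space') auto
  also have "\<dots> = 1"
    using assms by (simp add: sum_ennreal)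
  finally have pmf: "pmf (embed_pmf P) = P"
    using assms(2) by (intro ext pmf_embed_pmf) auto
  moreover have "set_pmf (embed_pmf P) \<subseteq> ?W"
  proof
    fix a assume "a \<in> set_pmf (embed_pmf P)"
    then have "P a \<noteq> 0" by (simp add: set_pmf_iff pmf)
    then show "a \<in> ?W" using assms(3)[of a] by blast
  qed
  ultimately show ?thesis
    unfolding joint_dist_def by (intro image_eqI[of _ _ "embed_pmf P"]) auto
qed

lemma dist_act_eq_sum:
  assumes "f \<in> simplex_hom m n"
  shows "dist_act \<Omega> m n f P a = (\<Sum>b\<in>{b \<in> words \<Omega> (n + 1). pullback f m b = a}. P b)"
proof (cases "a \<in> words \<Omega> (m + 1)")
  case True
  then show ?thesis
    by (simp add: dist_act_def pullback_eq_iff words_def)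
next
  case False
  then have "{b \<in> words \<Omega> (n + 1). pullback f m b = a} = {}"
    using pullback_words[OF assms] by auto
  then show ?thesis
    using False by (simp only: dist_act_def sum.empty if_False)
qed

text \<open>The action is the push-forward of distributions along the pullback of words, so that
  closure and functoriality come from the functoriality of \<^const>\<open>map_pmf\<close>.\<close>

lemma dist_act_pmf:
  assumes "finite \<Omega>" "f \<in> simplex_hom m n" "set_pmf p \<subseteq> words \<Omega> (n + 1)"
  shows "dist_act \<Omega> m n f (pmf p) = pmf (map_pmf (pullback f m) p)"
proof
  fix a
  let ?S = "{b \<in> words \<Omega> (n + 1). pullback f m b = a}"
  have "pmf (map_pmf (pullback f m) p) a = measure p (pullback f m -` {a})"
    by (rule pmf_map)
  also have "\<dots> = measure p ?S"
    using assms(3) by (intro measure_pmf.finite_measure_eq_AE) (auto simp: AE_measure_pmf_iff)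
  also have "\<dots> = sum (pmf p) ?S"
    using finite_words[OF assms(1)] by (intro measure_measure_pmf_finite) auto
  finally show "dist_act \<Omega> m n f (pmf p) a = pmf (map_pmf (pullback f m) p) a"
    by (simp add: dist_act_eq_sum[OF assms(2)])
qed

lemma simplex_hom_compose:
  "f \<in> simplex_hom l m \<Longrightarrow> g \<in> simplex_hom m n \<Longrightarrow> compose {..l} g f \<in> simplex_hom l n"
  by (auto simp: simplex_hom_def compose_def monotone_on_def PiE_iff)

lemma simplicial_set_joint_dist:
  assumes "finite \<Omega>"
  shows "simplicial_set (joint_dist \<Omega>) (dist_act \<Omega>)"
proof
  fix f m n A
  assume f: "f \<in> simplex_hom m n" and A: "A \<in> joint_dist \<Omega> n"
  obtain p where p: "A = pmf p" "set_pmf p \<subseteq> words \<Omega> (n + 1)"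
    using A by (rule joint_distE)
  have "set_pmf (map_pmf (pullback f m) p) \<subseteq> words \<Omega> (m + 1)"
    using p(2) pullback_words[OF f] by auto
  then show "dist_act \<Omega> m n f A \<in> joint_dist \<Omega> m"
    unfolding p(1) dist_act_pmf[OF assms f p(2)] joint_dist_def by blast
next
  fix A n
  assume A: "A \<in> joint_dist \<Omega> n"
  obtain p where p: "A = pmf p" "set_pmf p \<subseteq> words \<Omega> (n + 1)"
    using A by (rule joint_distE)
  have "map_pmf (pullback (\<lambda>i\<in>{..n}. i) n) p = map_pmf (\<lambda>b. b) p"
    using p(2) by (intro map_pmf_cong refl pullback_id) (auto simp: words_def)
  then show "dist_act \<Omega> n n (\<lambda>i\<in>{..n}. i) A = A"
    using dist_act_pmf[OF assms simplex_hom_id p(2)] p(1) by simp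
next
  fix f l m g n A
  assume f: "f \<in> simplex_hom l m" and g: "g \<in> simplex_hom m n" and A: "A \<in> joint_dist \<Omega> n"
  obtain p where p: "A = pmf p" "set_pmf p \<subseteq> words \<Omega> (n + 1)"
    using A by (rule joint_distE)
  have "set_pmf (map_pmf (pullback g m) p) \<subseteq> words \<Omega> (m + 1)"
    using p(2) pullback_words[OF g] by auto
  then show "dist_act \<Omega> l n (compose {..l} g f) A = dist_act \<Omega> l m f (dist_act \<Omega> m n g A)"
    using p f g
    by (simp add: dist_act_pmf[OF assms] simplex_hom_compose pmf.map_comp o_def
        pullback_compose[OF f, abs_def])
qed

section \<open>Marginals of initial and final blocks\<close>

lemma dist_act_s_map:
  assumes "m \<le> N" "a \<in> words \<Omega> (m + 1)"
  shows "dist_act \<Omega> m N (s_map m) D a = (\<Sum>y\<in>words \<Omega> (N - m). D (a @ y))"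
proof -
  have "dist_act \<Omega> m N (s_map m) D a
      = (\<Sum>b\<in>{b \<in> words \<Omega> (N + 1). \<forall>i\<le>m. a ! i = b ! i}. D b)"
    using assms(2) by (simp add: dist_act_def s_map_def cong: conj_cong)
  also have "\<dots> = (\<Sum>y\<in>words \<Omega> (N - m). D (a @ y))"
  proof (rule sum.reindex_bij_witness[of _ "\<lambda>y. a @ y" "drop (m + 1)"])
    fix b assume b: "b \<in> {b \<in> words \<Omega> (N + 1). \<forall>i\<le>m. a ! i = b ! i}"
    have "take (m + 1) b = a"
      using b assms by (intro nth_equalityI) (auto simp: words_def)
    then show "a @ drop (m + 1) b = b"
      by (metis append_take_drop_id)
    then show "D (a @ drop (m + 1) b) = D b" by simp
    show "drop (m + 1) b \<in> words \<Omega> (N - m)"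
      using b drop_words[of b \<Omega> "N + 1" "m + 1"] by simp
  next
    fix y assume y: "y \<in> words \<Omega> (N - m)"
    then show "drop (m + 1) (a @ y) = y" using assms by (simp add: words_def)
    show "a @ y \<in> {b \<in> words \<Omega> (N + 1). \<forall>i\<le>m. a ! i = b ! i}"
      using y assms by (auto simp: words_def nth_append)
  qed
  finally show ?thesis .
qed

lemma dist_act_t_map:
  assumes "n \<le> N" "a \<in> words \<Omega> (n + 1)"
  shows "dist_act \<Omega> n N (t_map n N) D a = (\<Sum>x\<in>words \<Omega> (N - n). D (x @ a))"
proof -
  have "dist_act \<Omega> n N (t_map n N) D a
      = (\<Sum>b\<in>{b \<in> words \<Omega> (N + 1). \<forall>i\<le>n. a ! i = b ! (i + (N - n))}. D b)"
    using assms(2) by (simp add: dist_act_def t_map_def cong: conj_cong)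
  also have "\<dots> = (\<Sum>x\<in>words \<Omega> (N - n). D (x @ a))"
  proof (rule sum.reindex_bij_witness[of _ "\<lambda>x. x @ a" "take (N - n)"])
    fix b assume b: "b \<in> {b \<in> words \<Omega> (N + 1). \<forall>i\<le>n. a ! i = b ! (i + (N - n))}"
    have "drop (N - n) b = a"
      using b assms by (intro nth_equalityI) (auto simp: words_def add.commute)
    then show "take (N - n) b @ a = b"
      by (metis append_take_drop_id)
    then show "D (take (N - n) b @ a) = D b" by simp
    show "take (N - n) b \<in> words \<Omega> (N - n)"
      using b take_words[of b \<Omega> "N + 1" "N - n"] by simp
  next
    fix x assume x: "x \<in> words \<Omega> (N - n)"
    then show "take (N - n) (x @ a) = x" by (simp add: words_def)
    show "x @ a \<in> {b \<in> words \<Omega> (N + 1). \<forall>i\<le>n. a ! i = b ! (i + (N - n))}"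
      using x assms by (auto simp: words_def nth_append)
  qed
  finally show ?thesis .
qed

text \<open>Words over the composite simplex are handled as \<open>x @ z @ y\<close>, with \<open>z\<close> the overlap of
  the two blocks.\<close>

lemma words_split3:
  assumes "a \<in> words \<Omega> (m + n - k + 1)" "k \<le> m" "k \<le> (n::nat)"
  obtains x z y where "a = x @ z @ y" "x \<in> words \<Omega> (m - k)" "z \<in> words \<Omega> (k + 1)"
    "y \<in> words \<Omega> (n - k)"
proof
  show "a = take (m - k) a @ take (k + 1) (drop (m - k) a) @ drop (k + 1) (drop (m - k) a)"
    by (simp only: append_take_drop_id)
  have d: "drop (m - k) a \<in> words \<Omega> (n + 1)"
    using drop_words[OF assms(1), of "m - k"] assms(2,3) by simp
  show "take (k + 1) (drop (m - k) a) \<in> words \<Omega> (k + 1)"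
    using take_words[OF d, of "k + 1"] assms(3) by simp
  show "drop (k + 1) (drop (m - k) a) \<in> words \<Omega> (n - k)"
    using drop_words[OF d, of "k + 1"] by simp
  show "take (m - k) a \<in> words \<Omega> (m - k)"
    using take_words[OF assms(1), of "m - k"] assms(2,3) by simp
qed

lemma dist_cmp_append:
  assumes "k \<le> m" "k \<le> n" "x \<in> words \<Omega> (m - k)" "z \<in> words \<Omega> (k + 1)" "y \<in> words \<Omega> (n - k)"
  shows "dist_cmp \<Omega> k m n P Q (x @ z @ y) = P (x @ z) * Q (z @ y) / overlap \<Omega> k m P z"
proof -
  have "x @ z @ y \<in> words \<Omega> (m + n - k + 1)"
    using append_words[OF assms(3) append_words[OF assms(4,5)]] assms(1,2)
    by (simp add: algebra_simps)
  moreover have "length x = m - k" "length z = k + 1"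
    using assms by (auto simp: words_def)
  ultimately show ?thesis
    using assms(1) by (simp add: dist_cmp_def Suc_diff_le)
qed

section \<open>Factorization and its stability under the simplicial action\<close>

text \<open>The factors are arbitrary functions, not distributions: this freedom is what makes the
  property easy to verify and to transport along simplicial maps.\<close>

definition factorizes ::
    "'o set \<Rightarrow> nat \<Rightarrow> nat \<Rightarrow> nat \<Rightarrow> ('o list \<Rightarrow> real) \<Rightarrow> ('o list \<Rightarrow> real) \<Rightarrow> ('o list \<Rightarrow> real) \<Rightarrow> bool"
  where "factorizes \<Omega> k m n f g D \<longleftrightarrow>
    (\<forall>a\<in>words \<Omega> (m + n - k + 1). D a = f (take (m + 1) a) * g (drop (m - k) a))"

lemma factorizes_dist_cmp:
  assumes "k \<le> m"
  shows "factorizes \<Omega> k m n P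
    (\<lambda>b. Q b / overlap \<Omega> k m P (take (k + 1) b)) (dist_cmp \<Omega> k m n P Q)"
  by (simp add: factorizes_def dist_cmp_def)

text \<open>By \<open>left\<close> and \<open>right\<close>, a word \<open>b\<close> satisfies \<open>b h = a\<close> iff its initial block is mapped to
  that of \<open>a\<close> by \<open>h\<^sub>1\<close> and its final block to that of \<open>a\<close> by \<open>h\<^sub>2\<close>. Conversely, two blocks with
  these properties always agree on the overlap and can be glued, because by \<open>onto\<close> each
  letter of the overlap occurs in \<open>a\<close>, at a position belonging to both blocks. So the words
  over \<open>a\<close> form a product set, on which the sum of \<open>f \<cdot> g\<close> is a product of sums.\<close>

lemma factorizes_dist_act:
  assumes "finite \<Omega>" "factorizes \<Omega> k m n f g D"
    and le: "k \<le> m" "k \<le> n" "k' \<le> m'" "k' \<le> n'"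
    and h1: "h\<^sub>1 \<in> simplex_hom m' m" and h2: "h\<^sub>2 \<in> simplex_hom n' n"
    and left: "\<And>v. v \<le> m' \<Longrightarrow> h v = h\<^sub>1 v"
    and right: "\<And>v. v \<le> n' \<Longrightarrow> h (v + (m' - k')) = h\<^sub>2 v + (m - k)"
    and onto: "{m - k..m} \<subseteq> h ` {m' - k'..m'}"
  shows "factorizes \<Omega> k' m' n' (dist_act \<Omega> m' m h\<^sub>1 f) (dist_act \<Omega> n' n h\<^sub>2 g)
    (dist_act \<Omega> (m' + n' - k') (m + n - k) h D)"
  unfolding factorizes_def
proof
  let ?N = "m + n - k" and ?N' = "m' + n' - k'"
  fix a assume a: "a \<in> words \<Omega> (?N' + 1)"
  define a1 a2 where "a1 = take (m' + 1) a" and "a2 = drop (m' - k') a"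
  have a12: "a1 \<in> words \<Omega> (m' + 1)" "a2 \<in> words \<Omega> (n' + 1)"
    using take_words[OF a, of "m' + 1"] drop_words[OF a, of "m' - k'"] le
    by (simp_all add: a1_def a2_def)
  have a1_nth: "a1 ! i = a ! i" if "i \<le> m'" for i
    using that by (simp add: a1_def)
  have a2_nth: "a2 ! i = a ! (i + (m' - k'))" for i
    using a le by (simp add: a2_def words_def add.commute)
  let ?S = "{b \<in> words \<Omega> (?N + 1). \<forall>i\<le>?N'. a ! i = b ! h i}"
  let ?S1 = "{b \<in> words \<Omega> (m + 1). \<forall>i\<le>m'. a1 ! i = b ! h\<^sub>1 i}"
  let ?S2 = "{b \<in> words \<Omega> (n + 1). \<forall>i\<le>n'. a2 ! i = b ! h\<^sub>2 i}"
  have overlap: "b1 ! (m - k + j) = b2 ! j" if b: "b1 \<in> ?S1" "b2 \<in> ?S2" and j: "j \<le> k" for b1 b2 j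
  proof -
    \<comment> \<open>Both letters equal \<open>a ! i\<close> for a position \<open>i\<close> of the new overlap above the vertex \<open>m - k + j\<close>.\<close>
    have "m - k + j \<in> h ` {m' - k'..m'}"
      using j le(1) by (intro subsetD[OF onto]) (simp, linarith)
    then obtain i where i: "i \<in> {m' - k'..m'}" "h i = m - k + j"
      by auto
    define v where "v = i - (m' - k')"
    have v: "i = v + (m' - k')" "v \<le> k'"
      using i(1) le(3) by (auto simp: v_def)
    have "h\<^sub>2 v = j"
      using right[of v] v i le by simp
    have "i \<le> m'" "v \<le> n'"
      using i(1) v(2) le(4) by auto
    then have "a1 ! i = b1 ! h\<^sub>1 i" "a2 ! v = b2 ! h\<^sub>2 v"
      using b by blast+
    then show ?thesis
      using \<open>i \<le> m'\<close> i(2) v(1) \<open>h\<^sub>2 v = j\<close> left[of i] a1_nth[of i] a2_nth[of v] by simp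
  qed
  have "dist_act \<Omega> m' m h\<^sub>1 f a1 * dist_act \<Omega> n' n h\<^sub>2 g a2 = (\<Sum>b1\<in>?S1. f b1) * (\<Sum>b2\<in>?S2. g b2)"
    using a12 by (simp add: dist_act_def)
  also have "\<dots> = (\<Sum>(b1, b2)\<in>?S1 \<times> ?S2. f b1 * g b2)"
    by (simp add: sum_product sum.cartesian_product)
  also have "\<dots> = (\<Sum>b\<in>?S. D b)"
  proof (rule sum.reindex_bij_witness[of _ "\<lambda>b. (take (m + 1) b, drop (m - k) b)"
        "\<lambda>(b1, b2). b1 @ drop (k + 1) b2"])
    fix b assume b: "b \<in> ?S"
    then have bw: "b \<in> words \<Omega> (?N + 1)" and bh: "\<And>i. i \<le> ?N' \<Longrightarrow> a ! i = b ! h i"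
      by auto
    have "drop (k + 1) (drop (m - k) b) = drop (m + 1) b"
      using le by simp
    then show "(case (take (m + 1) b, drop (m - k) b) of (b1, b2) \<Rightarrow> b1 @ drop (k + 1) b2) = b"
      by (simp only: prod.case append_take_drop_id)
    have "a1 ! i = take (m + 1) b ! h\<^sub>1 i" if "i \<le> m'" for i
      using that bh[of i] left[of i] simplex_hom_le[OF h1 that] a1_nth[of i] le by simp
    moreover have "a2 ! i = drop (m - k) b ! h\<^sub>2 i" if "i \<le> n'" for i
      using that bh[of "i + (m' - k')"] right[of i] a2_nth[of i] le bw
      by (simp add: words_def add.commute)
    ultimately show "(take (m + 1) b, drop (m - k) b) \<in> ?S1 \<times> ?S2"
      using take_words[OF bw, of "m + 1"] drop_words[OF bw, of "m - k"] le by simp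
  next
    fix b assume "b \<in> ?S1 \<times> ?S2"
    then obtain b1 b2 where b: "b = (b1, b2)" "b1 \<in> ?S1" "b2 \<in> ?S2"
      by (rule SigmaE)
    have len: "length b1 = m + 1" "length b2 = n + 1"
      using b by (auto simp: words_def)
    let ?c = "b1 @ drop (k + 1) b2"
    have c1: "take (m + 1) ?c = b1"
      using len by simp
    have "drop (m - k) b1 = take (k + 1) b2"
      using len le overlap[OF b(2,3)] by (intro nth_equalityI) auto
    then have c2: "drop (m - k) ?c = b2"
      using len le by simp
    show "(case (case b of (b1, b2) \<Rightarrow> b1 @ drop (k + 1) b2) of b \<Rightarrow>
        (take (m + 1) b, drop (m - k) b)) = b"
      unfolding b(1) by (simp only: prod.case c1 c2)
    have cw: "?c \<in> words \<Omega> (?N + 1)"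
      using append_words[of b1 \<Omega> "m + 1" "drop (k + 1) b2" "n - k"]
        drop_words[of b2 \<Omega> "n + 1" "k + 1"] b le by simp
    have "a ! i = ?c ! h i" if i: "i \<le> ?N'" for i
    proof (cases "i \<le> m'")
      case True
      then show ?thesis
        using b(2) left[of i] simplex_hom_le[OF h1 True] a1_nth[of i] len by (simp add: nth_append)
    next
      case False
      define v where "v = i - (m' - k')"
      have v: "i = v + (m' - k')" "v \<le> n'"
        using False i le by (auto simp: v_def)
      have "a ! i = b2 ! h\<^sub>2 v"
        using b(3) v a2_nth[of v] by simp
      also have "\<dots> = ?c ! (m - k + h\<^sub>2 v)"
        using nth_drop[of "m - k" ?c "h\<^sub>2 v"] len by (simp only: c2) simp
      finally show ?thesis
        using right[of v] v by (simp add: add.commute)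
    qed
    then show "(case b of (b1, b2) \<Rightarrow> b1 @ drop (k + 1) b2) \<in> ?S"
      unfolding b(1) prod.case using cw by blast
    show "D (case b of (b1, b2) \<Rightarrow> b1 @ drop (k + 1) b2) = (case b of (b1, b2) \<Rightarrow> f b1 * g b2)"
      using bspec[OF assms(2)[unfolded factorizes_def] cw] unfolding c1 c2 b(1) by simp
  qed
  finally show "dist_act \<Omega> ?N' ?N h D a
      = dist_act \<Omega> m' m h\<^sub>1 f (take (m' + 1) a) * dist_act \<Omega> n' n h\<^sub>2 g (drop (m' - k') a)"
    using a by (simp add: dist_act_def a1_def a2_def)
qed

section \<open>Composition as conditionally independent gluing\<close>

context
  fixes \<Omega> :: "'o set"
  assumes fin: "finite \<Omega>"
begin

interpretation simplicial_set "joint_dist \<Omega>" "dist_act \<Omega>"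
  by (rule simplicial_set_joint_dist[OF fin])

text \<open>The denominator of the composition cancels where it is nonzero. Where it vanishes, so does
  \<open>D\<close>, because \<open>D\<close> is nonnegative and the denominator is a marginal of \<open>D\<close>; this agrees with the
  convention \<open>x / 0 = 0\<close>.\<close>

lemma factorizes_imp_dist_cmp_marginals:
  assumes D: "D \<in> joint_dist \<Omega> (m + n - k)" and le: "k \<le> m" "k \<le> n"
    and fac: "factorizes \<Omega> k m n f g D"
  defines "P \<equiv> dist_act \<Omega> m (m + n - k) (s_map m) D"
    and "Q \<equiv> dist_act \<Omega> n (m + n - k) (t_map n (m + n - k)) D"
  shows "composable k m n P Q \<and> dist_cmp \<Omega> k m n P Q = D"
proof
  let ?N = "m + n - k"
  have homs: "s_map m \<in> simplex_hom m ?N" "t_map n ?N \<in> simplex_hom n ?N"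
    "t_map k m \<in> simplex_hom k m" "s_map k \<in> simplex_hom k n"
    using le by (auto intro!: s_map_hom t_map_hom)
  have PQ: "P \<in> joint_dist \<Omega> m" "Q \<in> joint_dist \<Omega> n"
    unfolding P_def Q_def using homs D by (auto intro: act_closed)
  \<comment> \<open>Both composites are the inclusion of the overlap, so the two marginals agree on it.\<close>
  have "compose {..k} (s_map m) (t_map k m) = compose {..k} (t_map n ?N) (s_map k)"
    using le by (auto simp: compose_def s_map_def t_map_def fun_eq_iff)
  then show "composable k m n P Q"
    unfolding composable_def using le PQ homs D
    by (simp add: P_def Q_def act_compose[symmetric])
  show "dist_cmp \<Omega> k m n P Q = D"
  proof
    fix a
    show "dist_cmp \<Omega> k m n P Q a = D a"
    proof (cases "a \<in> words \<Omega> (?N + 1)")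
      case False
      then show ?thesis
        using joint_dist_zero[OF D] by (simp add: dist_cmp_def)
    next
      case True
      then obtain x z y where a: "a = x @ z @ y" and x: "x \<in> words \<Omega> (m - k)"
        and z: "z \<in> words \<Omega> (k + 1)" and y: "y \<in> words \<Omega> (n - k)"
        using le by (rule words_split3)
      define F G where "F = (\<Sum>x\<in>words \<Omega> (m - k). f (x @ z))"
        and "G = (\<Sum>y\<in>words \<Omega> (n - k). g (z @ y))"
      have D_eq: "D (x @ z @ y) = f (x @ z) * g (z @ y)"
        if "x \<in> words \<Omega> (m - k)" "y \<in> words \<Omega> (n - k)" for x y
      proof -
        have "x @ z @ y \<in> words \<Omega> (?N + 1)"
          using append_words[OF that(1) append_words[OF z that(2)]] le
          by (simp add: algebra_simps)
        moreover have "length x = m - k" "length z = k + 1"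
          using that z by (auto simp: words_def)
        ultimately show ?thesis
          using fac le by (simp add: factorizes_def Suc_diff_le)
      qed
      have P_sum: "P (x @ z) = (\<Sum>y\<in>words \<Omega> (n - k). D (x @ z @ y))"
        if "x \<in> words \<Omega> (m - k)" for x
        using dist_act_s_map[of m ?N "x @ z" \<Omega> D] append_words[OF that z] le
        by (simp add: P_def)
      have P_eq: "P (x @ z) = f (x @ z) * G" if "x \<in> words \<Omega> (m - k)" for x
        using that by (simp add: P_sum D_eq G_def sum_distrib_left)
      have Q_eq: "Q (z @ y) = F * g (z @ y)"
        using dist_act_t_map[of n ?N "z @ y" \<Omega> D] append_words[OF z y] le y
        by (simp add: Q_def F_def D_eq sum_distrib_right)
      have R_eq: "overlap \<Omega> k m P z = F * G"
        by (simp add: overlap_def P_eq F_def sum_distrib_right)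
      have "D a = P (x @ z) * Q (z @ y) / overlap \<Omega> k m P z"
      proof (cases "F * G = 0")
        case True
        then have "(\<Sum>x\<in>words \<Omega> (m - k). P (x @ z)) = 0"
          using R_eq by (simp add: overlap_def)
        then have "P (x @ z) = 0"
          using x joint_dist_nonneg[OF PQ(1)] finite_words[OF fin]
          by (simp add: sum_nonneg_eq_0_iff)
        then have "D a = 0"
          using P_sum[OF x] a y joint_dist_nonneg[OF D] finite_words[OF fin]
          by (simp add: sum_nonneg_eq_0_iff)
        then show ?thesis
          using True R_eq by simp
      next
        case False
        then show ?thesis
          using a D_eq[OF x y] P_eq[OF x] Q_eq R_eq by simp
      qed
      then show ?thesis
        using dist_cmp_append[OF le x z y] a by simp
    qed
  qed
qed

text \<open>The denominator is the overlap marginal of \<open>P\<close> and, by \<open>overlap_eq\<close>, of \<open>Q\<close>. Summing out the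
  rest of one block therefore reproduces it and cancels it; where it is zero, both \<open>P\<close>
  and \<open>Q\<close> vanish by nonnegativity.\<close>

lemma dist_cmp_marginals:
  assumes PQ: "composable k m n P Q"
  defines "D \<equiv> dist_cmp \<Omega> k m n P Q"
  shows "dist_act \<Omega> m (m + n - k) (s_map m) D = P"
    and "dist_act \<Omega> n (m + n - k) (t_map n (m + n - k)) D = Q"
proof -
  let ?N = "m + n - k" and ?R = "overlap \<Omega> k m P"
  have le: "k \<le> m" "k \<le> n" and P: "P \<in> joint_dist \<Omega> m" and Q: "Q \<in> joint_dist \<Omega> n"
    and comp: "dist_act \<Omega> k m (t_map k m) P = dist_act \<Omega> k n (s_map k) Q"
    using PQ by (auto simp: composable_def)
  note nonneg = joint_dist_nonneg[OF P] joint_dist_nonneg[OF Q]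
  note R_eq = overlap_eq[OF le _ comp]
  have P0: "P (x @ z) = 0" if "x \<in> words \<Omega> (m - k)" "?R z = 0" for x z
    using that nonneg finite_words[OF fin] by (simp add: overlap_def sum_nonneg_eq_0_iff)
  have Q0: "Q (z @ y) = 0" if "z \<in> words \<Omega> (k + 1)" "y \<in> words \<Omega> (n - k)" "?R z = 0" for z y
    using that nonneg finite_words[OF fin] R_eq[OF that(1)] by (simp add: sum_nonneg_eq_0_iff)
  show "dist_act \<Omega> m ?N (s_map m) D = P"
  proof
    fix a
    show "dist_act \<Omega> m ?N (s_map m) D a = P a"
    proof (cases "a \<in> words \<Omega> (m + 1)")
      case False
      then show ?thesis
        using joint_dist_zero[OF P] by (simp add: dist_act_def)
    next
      case True
      define x z where "x = take (m - k) a" and "z = drop (m - k) a"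
      have a: "a = x @ z" and x: "x \<in> words \<Omega> (m - k)" and z: "z \<in> words \<Omega> (k + 1)"
        using take_words[OF True, of "m - k"] drop_words[OF True, of "m - k"] le
        by (auto simp: x_def z_def)
      have "dist_act \<Omega> m ?N (s_map m) D a = (\<Sum>y\<in>words \<Omega> (n - k). D (x @ z @ y))"
        using dist_act_s_map[of m ?N a \<Omega> D] True le by (simp add: a)
      also have "\<dots> = (\<Sum>y\<in>words \<Omega> (n - k). P (x @ z) / ?R z * Q (z @ y))"
        using le x z by (intro sum.cong) (simp_all add: D_def dist_cmp_append)
      also have "\<dots> = P (x @ z) / ?R z * ?R z"
        by (simp only: R_eq[OF z] sum_distrib_left)
      also have "\<dots> = P a"
        using P0[OF x] a by auto
      finally show ?thesis .
    qed
  qed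
  show "dist_act \<Omega> n ?N (t_map n ?N) D = Q"
  proof
    fix a
    show "dist_act \<Omega> n ?N (t_map n ?N) D a = Q a"
    proof (cases "a \<in> words \<Omega> (n + 1)")
      case False
      then show ?thesis
        using joint_dist_zero[OF Q] by (simp add: dist_act_def)
    next
      case True
      define z y where "z = take (k + 1) a" and "y = drop (k + 1) a"
      have a: "a = z @ y" and z: "z \<in> words \<Omega> (k + 1)" and y: "y \<in> words \<Omega> (n - k)"
        using take_words[OF True, of "k + 1"] drop_words[OF True, of "k + 1"] le
        by (auto simp: z_def y_def)
      have "dist_act \<Omega> n ?N (t_map n ?N) D a = (\<Sum>x\<in>words \<Omega> (m - k). D (x @ z @ y))"
        using dist_act_t_map[of n ?N a \<Omega> D] True le by (simp add: a)
      also have "\<dots> = (\<Sum>x\<in>words \<Omega> (m - k). P (x @ z) * (Q (z @ y) / ?R z))"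
        using le z y by (intro sum.cong) (simp_all add: D_def dist_cmp_append)
      also have "\<dots> = ?R z * (Q (z @ y) / ?R z)"
        by (simp only: overlap_def sum_distrib_right)
      also have "\<dots> = Q a"
        using Q0[OF z y] a by auto
      finally show ?thesis .
    qed
  qed
qed

text \<open>The total mass of the composition is that of its marginal \<open>P\<close>.\<close>

lemma dist_cmp_closed:
  assumes PQ: "composable k m n P Q"
  shows "dist_cmp \<Omega> k m n P Q \<in> joint_dist \<Omega> (m + n - k)"
proof (rule joint_distI[OF fin])
  let ?N = "m + n - k" and ?D = "dist_cmp \<Omega> k m n P Q"
  have le: "k \<le> m" "k \<le> n" and P: "P \<in> joint_dist \<Omega> m" and Q: "Q \<in> joint_dist \<Omega> n"
    using PQ by (auto simp: composable_def)
  show "0 \<le> ?D a" for a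
    using joint_dist_nonneg[OF P] joint_dist_nonneg[OF Q]
    by (simp add: dist_cmp_def overlap_def sum_nonneg)
  show "a \<notin> words \<Omega> (?N + 1) \<Longrightarrow> ?D a = 0" for a
    by (simp add: dist_cmp_def)
  have s: "s_map m \<in> simplex_hom m ?N"
    using le by (intro s_map_hom) simp
  obtain p where p: "P = pmf p" "set_pmf p \<subseteq> words \<Omega> (m + 1)"
    using P by (rule joint_distE)
  have "1 = sum P (words \<Omega> (m + 1))"
    using sum_pmf_eq_1[OF finite_words[OF fin] p(2)] p(1) by simp
  also have "\<dots> = (\<Sum>a\<in>words \<Omega> (m + 1).
      \<Sum>b\<in>{b \<in> words \<Omega> (?N + 1). pullback (s_map m) m b = a}. ?D b)"
    by (simp only: dist_cmp_marginals(1)[OF PQ] dist_act_eq_sum[OF s, symmetric])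
  also have "\<dots> = sum ?D (words \<Omega> (?N + 1))"
    using pullback_words[OF s] by (intro sum.group finite_words fin) blast
  finally show "sum ?D (words \<Omega> (?N + 1)) = 1" ..
qed

text \<open>The common source of the degeneracy and face laws: \<open>h\<close> restricts to \<open>h\<^sub>1\<close> and \<open>h\<^sub>2\<close> on the
  two blocks and covers the overlap. The image of the composition factorizes, and
  functoriality identifies its marginals.\<close>

lemma dist_cmp_natural:
  assumes PQ: "composable k m n P Q" and le': "k' \<le> m'" "k' \<le> n'"
    and N': "N' = m' + n' - k'" and h: "h \<in> simplex_hom N' (m + n - k)"
    and h1: "h\<^sub>1 \<in> simplex_hom m' m" and h2: "h\<^sub>2 \<in> simplex_hom n' n"
    and left: "\<And>v. v \<le> m' \<Longrightarrow> h v = h\<^sub>1 v"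
    and right: "\<And>v. v \<le> n' \<Longrightarrow> h (v + (m' - k')) = h\<^sub>2 v + (m - k)"
    and onto: "{m - k..m} \<subseteq> h ` {m' - k'..m'}"
  shows "composable k' m' n' (dist_act \<Omega> m' m h\<^sub>1 P) (dist_act \<Omega> n' n h\<^sub>2 Q) \<and>
    dist_act \<Omega> N' (m + n - k) h (dist_cmp \<Omega> k m n P Q)
      = dist_cmp \<Omega> k' m' n' (dist_act \<Omega> m' m h\<^sub>1 P) (dist_act \<Omega> n' n h\<^sub>2 Q)"
proof -
  let ?N = "m + n - k" 
  let ?D = "dist_cmp \<Omega> k m n P Q"
  let ?E = "dist_act \<Omega> N' ?N h ?D"
  have le: "k \<le> m" "k \<le> n"
    using PQ by (auto simp: composable_def)
  note D = dist_cmp_closed[OF PQ]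
  have homs: "s_map m \<in> simplex_hom m ?N" "t_map n ?N \<in> simplex_hom n ?N"
    "s_map m' \<in> simplex_hom m' N'" "t_map n' N' \<in> simplex_hom n' N'"
    using le le' N' by (auto intro!: s_map_hom t_map_hom)
  have "compose {..m'} h (s_map m') = compose {..m'} (s_map m) h\<^sub>1"
    using left simplex_hom_le[OF h1] by (auto simp: compose_def s_map_def fun_eq_iff)
  then have "dist_act \<Omega> m' N' (s_map m') ?E = dist_act \<Omega> m' m h\<^sub>1 (dist_act \<Omega> m ?N (s_map m) ?D)"
    using homs h h1 D by (simp add: act_compose[symmetric])
  then have E1: "dist_act \<Omega> m' N' (s_map m') ?E = dist_act \<Omega> m' m h\<^sub>1 P"
    by (simp only: dist_cmp_marginals(1)[OF PQ])
  have "compose {..n'} h (t_map n' N') = compose {..n'} (t_map n ?N) h\<^sub>2"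
    using right simplex_hom_le[OF h2] le le' N'
    by (auto simp: compose_def t_map_def fun_eq_iff)
  then have "dist_act \<Omega> n' N' (t_map n' N') ?E
      = dist_act \<Omega> n' n h\<^sub>2 (dist_act \<Omega> n ?N (t_map n ?N) ?D)"
    using homs h h2 D by (simp add: act_compose[symmetric])
  then have E2: "dist_act \<Omega> n' N' (t_map n' N') ?E = dist_act \<Omega> n' n h\<^sub>2 Q"
    by (simp only: dist_cmp_marginals(2)[OF PQ])
  have "?E \<in> joint_dist \<Omega> N'"
    using h D by (rule act_closed)
  from factorizes_imp_dist_cmp_marginals[OF this[unfolded N'] le' factorizes_dist_act[OF fin
        factorizes_dist_cmp[OF le(1)] le le' h1 h2 left right onto]]
  show ?thesis
    by (simp only: N'[symmetric] E1 E2 simp_thms)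
qed

section \<open>The laws of a compository\<close>

lemma dist_cmp_identity_left:
  assumes "A \<in> joint_dist \<Omega> n" "k \<le> n"
  shows "composable k k n (dist_act \<Omega> k n (s_map k) A) A \<and>
    dist_cmp \<Omega> k k n (dist_act \<Omega> k n (s_map k) A) A = A"
proof -
  have "factorizes \<Omega> k k n (\<lambda>_. 1) A A"
    by (simp add: factorizes_def)
  moreover have "t_map n n = (\<lambda>i\<in>{..n}. i)"
    by (simp add: t_map_def)
  ultimately show ?thesis
    using factorizes_imp_dist_cmp_marginals[of A k n k "\<lambda>_. 1" A] assms act_id by simp
qed

lemma dist_cmp_identity_right:
  assumes "A \<in> joint_dist \<Omega> n" "k \<le> n"
  shows "composable k n k A (dist_act \<Omega> k n (t_map k n) A) \<and>
    dist_cmp \<Omega> k n k A (dist_act \<Omega> k n (t_map k n) A) = A"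
proof -
  have "factorizes \<Omega> k n k A (\<lambda>_. 1) A"
    by (auto simp: factorizes_def words_def)
  then show ?thesis
    using factorizes_imp_dist_cmp_marginals[of A n k k A "\<lambda>_. 1"] assms act_id
    by (simp add: s_map_def)
qed

text \<open>Enlarging the initial block moves the division by the overlap marginal into the first factor
  and leaves \<open>Q\<close> as the second one; in the mirror image \<open>P\<close> stays the first factor.\<close>

lemma dist_cmp_back_and_forth_left:
  assumes PQ: "composable k m n P Q" and i: "i \<le> n - k"
  defines "D \<equiv> dist_cmp \<Omega> k m n P Q"
  shows "composable (k + i) (m + i) n (dist_act \<Omega> (m + i) (m + n - k) (s_map (m + i)) D) Q \<and>
    dist_cmp \<Omega> (k + i) (m + i) n (dist_act \<Omega> (m + i) (m + n - k) (s_map (m + i)) D) Q = D"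
proof -
  have le: "k \<le> m" "k \<le> n"
    using PQ by (auto simp: composable_def)
  have N: "m + i + n - (k + i) = m + n - k"
    by simp
  have "factorizes \<Omega> (k + i) (m + i) n
      (\<lambda>b. P (take (m + 1) b) / overlap \<Omega> k m P (take (k + 1) (drop (m - k) b))) Q D"
    using le by (auto simp: factorizes_def D_def dist_cmp_def take_drop min_def)
  from factorizes_imp_dist_cmp_marginals[OF _ _ _ this, unfolded N]
  show ?thesis
    using dist_cmp_closed[OF PQ] le i dist_cmp_marginals(2)[OF PQ] by (simp add: D_def)
qed

lemma dist_cmp_back_and_forth_right:
  assumes PQ: "composable k m n P Q" and j: "j \<le> m - k"
  defines "D \<equiv> dist_cmp \<Omega> k m n P Q"
  shows "composable (k + j) m (n + j) P
      (dist_act \<Omega> (n + j) (m + n - k) (t_map (n + j) (m + n - k)) D) \<and>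
    dist_cmp \<Omega> (k + j) m (n + j) P
      (dist_act \<Omega> (n + j) (m + n - k) (t_map (n + j) (m + n - k)) D) = D"
proof -
  have le: "k \<le> m" "k \<le> n"
    using PQ by (auto simp: composable_def)
  have N: "m + (n + j) - (k + j) = m + n - k"
    by simp
  have "m - k = j + (m - (k + j))"
    using le j by simp
  then have "factorizes \<Omega> (k + j) m (n + j) P
      (\<lambda>b. Q (drop j b) / overlap \<Omega> k m P (take (k + 1) (drop j b))) D"
    by (simp add: factorizes_def D_def dist_cmp_def)
  from factorizes_imp_dist_cmp_marginals[OF _ _ _ this, unfolded N]
  show ?thesis
    using dist_cmp_closed[OF PQ] le j dist_cmp_marginals(1)[OF PQ] by (simp add: D_def)
qed

text \<open>In each law below, \<open>h\<close> is a degeneracy or a face of the composite simplex. A degeneracy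
  inserts a copy of a vertex, which belongs to the initial block only, to the final block only,
  or to the overlap; copies of an end of the overlap can be counted in or out, so the ranges of
  \<open>i\<close> meet. A face omits a vertex outside the overlap. A block that is not affected is acted on
  by the identity.\<close>

lemma dist_cmp_degeneracy_left:
  assumes PQ: "composable k m n P Q" and i: "i \<le> m - k"
  shows "composable k (m + 1) n (dist_act \<Omega> (m + 1) m (degen_map m i) P) Q \<and>
    dist_act \<Omega> (m + n - k + 1) (m + n - k) (degen_map (m + n - k) i) (dist_cmp \<Omega> k m n P Q)
      = dist_cmp \<Omega> k (m + 1) n (dist_act \<Omega> (m + 1) m (degen_map m i) P) Q"
proof -
  have le: "k \<le> m" "k \<le> n" and Q: "Q \<in> joint_dist \<Omega> n"
    using PQ by (auto simp: composable_def)
  have homs: "degen_map (m + n - k) i \<in> simplex_hom (m + n - k + 1) (m + n - k)"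
    "degen_map m i \<in> simplex_hom (m + 1) m" "(\<lambda>v\<in>{..n}. v) \<in> simplex_hom n n"
    by (intro degen_map_hom simplex_hom_id; use i le in simp)+
  have left: "degen_map (m + n - k) i v = degen_map m i v" if "v \<le> m + 1" for v
    using that i le by (auto simp: degen_map_def)
  have right: "degen_map (m + n - k) i (v + (m + 1 - k)) = (\<lambda>v\<in>{..n}. v) v + (m - k)"
    if "v \<le> n" for v
    using that i le by (auto simp: degen_map_def)
  have onto: "{m - k..m} \<subseteq> degen_map (m + n - k) i ` {m + 1 - k..m + 1}"
  proof
    fix v assume "v \<in> {m - k..m}"
    then show "v \<in> degen_map (m + n - k) i ` {m + 1 - k..m + 1}"
      using i le by (intro image_eqI[of _ _ "v + 1"]) (auto simp: degen_map_def)
  qed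
  show ?thesis
    by (rule dist_cmp_natural[OF PQ _ _ _ homs left right onto, unfolded act_id[OF Q]]) (use i le in simp_all)
qed

lemma dist_cmp_degeneracy_right:
  assumes PQ: "composable k m n P Q" and i: "m \<le> i" "i \<le> m + n - k"
  shows "composable k m (n + 1) P (dist_act \<Omega> (n + 1) n (degen_map n (i + k - m)) Q) \<and>
    dist_act \<Omega> (m + n - k + 1) (m + n - k) (degen_map (m + n - k) i) (dist_cmp \<Omega> k m n P Q)
      = dist_cmp \<Omega> k m (n + 1) P (dist_act \<Omega> (n + 1) n (degen_map n (i + k - m)) Q)"
proof -
  have le: "k \<le> m" "k \<le> n" and P: "P \<in> joint_dist \<Omega> m"
    using PQ by (auto simp: composable_def)
  have homs: "degen_map (m + n - k) i \<in> simplex_hom (m + n - k + 1) (m + n - k)"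
    "(\<lambda>v\<in>{..m}. v) \<in> simplex_hom m m" "degen_map n (i + k - m) \<in> simplex_hom (n + 1) n"
    by (intro degen_map_hom simplex_hom_id; use i le in simp)+
  have left: "degen_map (m + n - k) i v = (\<lambda>v\<in>{..m}. v) v" if "v \<le> m" for v
    using that i le by (auto simp: degen_map_def)
  have right: "degen_map (m + n - k) i (v + (m - k)) = degen_map n (i + k - m) v + (m - k)"
    if "v \<le> n + 1" for v
    using that i le by (auto simp: degen_map_def)
  have onto: "{m - k..m} \<subseteq> degen_map (m + n - k) i ` {m - k..m}"
  proof
    fix v assume "v \<in> {m - k..m}"
    then show "v \<in> degen_map (m + n - k) i ` {m - k..m}"
      using i le by (intro image_eqI[of _ _ "v"]) (auto simp: degen_map_def)
  qed
  show ?thesis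
    by (rule dist_cmp_natural[OF PQ _ _ _ homs left right onto, unfolded act_id[OF P]]) (use i le in simp_all)
qed

lemma dist_cmp_degeneracy_middle:
  assumes PQ: "composable k m n P Q" and i: "m - k \<le> i" "i \<le> m"
  shows "composable (k + 1) (m + 1) (n + 1) (dist_act \<Omega> (m + 1) m (degen_map m i) P)
      (dist_act \<Omega> (n + 1) n (degen_map n (i + k - m)) Q) \<and>
    dist_act \<Omega> (m + n - k + 1) (m + n - k) (degen_map (m + n - k) i) (dist_cmp \<Omega> k m n P Q)
      = dist_cmp \<Omega> (k + 1) (m + 1) (n + 1) (dist_act \<Omega> (m + 1) m (degen_map m i) P)
          (dist_act \<Omega> (n + 1) n (degen_map n (i + k - m)) Q)"
proof -
  have le: "k \<le> m" "k \<le> n"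
    using PQ by (auto simp: composable_def)
  have homs: "degen_map (m + n - k) i \<in> simplex_hom (m + n - k + 1) (m + n - k)"
    "degen_map m i \<in> simplex_hom (m + 1) m" "degen_map n (i + k - m) \<in> simplex_hom (n + 1) n"
    by (intro degen_map_hom simplex_hom_id; use i le in simp)+
  have left: "degen_map (m + n - k) i v = degen_map m i v" if "v \<le> m + 1" for v
    using that i le by (auto simp: degen_map_def)
  have right: "degen_map (m + n - k) i (v + (m + 1 - (k + 1))) = degen_map n (i + k - m) v + (m - k)"
    if "v \<le> n + 1" for v
    using that i le by (auto simp: degen_map_def)
  have onto: "{m - k..m} \<subseteq> degen_map (m + n - k) i ` {m + 1 - (k + 1)..m + 1}"
  proof
    fix v assume "v \<in> {m - k..m}"
    then show "v \<in> degen_map (m + n - k) i ` {m + 1 - (k + 1)..m + 1}"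
      using i le by (intro image_eqI[of _ _ "if v \<le> i then v else v + 1"]) (auto simp: degen_map_def)
  qed
  show ?thesis
    by (rule dist_cmp_natural[OF PQ _ _ _ homs left right onto]) (use i le in simp_all)
qed

lemma dist_cmp_face_left:
  assumes PQ: "composable k m n P Q" and i: "i < m - k"
  shows "composable k (m - 1) n (dist_act \<Omega> (m - 1) m (face_map m i) P) Q \<and>
    dist_act \<Omega> (m + n - k - 1) (m + n - k) (face_map (m + n - k) i) (dist_cmp \<Omega> k m n P Q)
      = dist_cmp \<Omega> k (m - 1) n (dist_act \<Omega> (m - 1) m (face_map m i) P) Q"
proof -
  have le: "k \<le> m" "k \<le> n" and Q: "Q \<in> joint_dist \<Omega> n"
    using PQ by (auto simp: composable_def)
  have homs: "face_map (m + n - k) i \<in> simplex_hom (m + n - k - 1) (m + n - k)"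
    "face_map m i \<in> simplex_hom (m - 1) m" "(\<lambda>v\<in>{..n}. v) \<in> simplex_hom n n"
    by (intro face_map_hom simplex_hom_id; use i le in simp)+
  have left: "face_map (m + n - k) i v = face_map m i v" if "v \<le> m - 1" for v
    using that i le by (auto simp: face_map_def)
  have right: "face_map (m + n - k) i (v + (m - 1 - k)) = (\<lambda>v\<in>{..n}. v) v + (m - k)"
    if "v \<le> n" for v
    using that i le by (auto simp: face_map_def)
  have onto: "{m - k..m} \<subseteq> face_map (m + n - k) i ` {m - 1 - k..m - 1}"
  proof
    fix v assume "v \<in> {m - k..m}"
    then show "v \<in> face_map (m + n - k) i ` {m - 1 - k..m - 1}"
      using i le by (intro image_eqI[of _ _ "v - 1"]) (auto simp: face_map_def)
  qed
  show ?thesis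
    by (rule dist_cmp_natural[OF PQ _ _ _ homs left right onto, unfolded act_id[OF Q]]) (use i le in simp_all)
qed

lemma dist_cmp_face_right:
  assumes PQ: "composable k m n P Q" and i: "m < i" "i \<le> m + n - k"
  shows "composable k m (n - 1) P (dist_act \<Omega> (n - 1) n (face_map n (i + k - m)) Q) \<and>
    dist_act \<Omega> (m + n - k - 1) (m + n - k) (face_map (m + n - k) i) (dist_cmp \<Omega> k m n P Q)
      = dist_cmp \<Omega> k m (n - 1) P (dist_act \<Omega> (n - 1) n (face_map n (i + k - m)) Q)"
proof -
  have le: "k \<le> m" "k \<le> n" and P: "P \<in> joint_dist \<Omega> m"
    using PQ by (auto simp: composable_def)
  have homs: "face_map (m + n - k) i \<in> simplex_hom (m + n - k - 1) (m + n - k)"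
    "(\<lambda>v\<in>{..m}. v) \<in> simplex_hom m m" "face_map n (i + k - m) \<in> simplex_hom (n - 1) n"
    by (intro face_map_hom simplex_hom_id; use i le in simp)+
  have left: "face_map (m + n - k) i v = (\<lambda>v\<in>{..m}. v) v" if "v \<le> m" for v
    using that i le by (auto simp: face_map_def)
  have right: "face_map (m + n - k) i (v + (m - k)) = face_map n (i + k - m) v + (m - k)"
    if "v \<le> n - 1" for v
    using that i le by (auto simp: face_map_def)
  have onto: "{m - k..m} \<subseteq> face_map (m + n - k) i ` {m - k..m}"
  proof
    fix v assume "v \<in> {m - k..m}"
    then show "v \<in> face_map (m + n - k) i ` {m - k..m}"
      using i le by (intro image_eqI[of _ _ "v"]) (auto simp: face_map_def)
  qed
  show ?thesis
    by (rule dist_cmp_natural[OF PQ _ _ _ homs left right onto, unfolded act_id[OF P]]) (use i le in simp_all)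
qed

end

theorem proposition3p4p2:
  fixes \<Omega> :: "'o set"
  assumes "finite \<Omega>"
  shows "compository (joint_dist \<Omega>) (dist_act \<Omega>) (dist_cmp \<Omega>)"
proof -
  interpret simplicial_set "joint_dist \<Omega>" "dist_act \<Omega>"
    by (rule simplicial_set_joint_dist[OF assms])
  note laws = dist_cmp_closed dist_cmp_identity_left dist_cmp_identity_right
    dist_cmp_back_and_forth_left dist_cmp_back_and_forth_right
    dist_cmp_degeneracy_left dist_cmp_degeneracy_right dist_cmp_degeneracy_middle
    dist_cmp_face_left dist_cmp_face_right
  show ?thesis
    by unfold_locales (fact laws[OF assms])+
qed

end
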